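(* Assume that $\mathcal E^J$ defines a scalar product on $\operatorname{dom}J$ and that $\ker J$ is $\mathcal E^J$-closed (i.e. closed in $\mathcal H^J$). Then $\operatorname{dom}J=\mathcal H^J_{\mathrm{har}}\oplus\ker J$ (direct sum of vector spaces). Moreover, $$\mathcal E_{\mathrm{har}}[Ju]=\mathcal E[P^Ju]\quad\text{for all }u\in\operatorname{dom}J.$$
   Context: Let $\mathcal H,\mathcal H_{\mathrm{aux}}$ be Hilbert spaces, with norm $\|\cdot\|_{\mathrm{aux}}$ on $\mathcal H_{\mathrm{aux}}$. Let $\mathcal E$ be a closed positive (i.e. symmetric, nonnegative) quadratic form with domain $\mathcal D\subseteq\mathcal H$; write $\mathcal E(\cdot,\cdot)$ for the associated sesquilinear form, $\mathcal E[u]:=\mathcal E(u,u)$, and $\mathcal E_1[u]:=\mathcal E[u]+\|u\|^2$. Let $J\colon\operatorname{dom}J\subseteq\mathcal D\to\mathcal H_{\mathrm{aux}}$ be a linear operator with dense range which is closed as an operator from $(\mathcal D,\mathcal E_1^{1/2})$ to $\mathcal H_{\mathrm{aux}}$. Set $\mathcal H^J_{\mathrm{har}}:=\{u\in\operatorname{dom}J:\ \mathcal E(u,v)=0\text{ for all }v\in\ker J\}$. When $\operatorname{dom}J=\mathcal H^J_{\mathrm{har}}\oplus\ker J$, let $E_{\mathrm{har}}$ be the projection from $\operatorname{dom}J$ onto $\mathcal H^J_{\mathrm{har}}$ along $\ker J$, and define the form $\mathcal E_{\mathrm{har}}$ in $\mathcal H_{\mathrm{aux}}$ by $\operatorname{dom}\mathcal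 E_{\mathrm{har}}:=\operatorname{ran}J$, $\mathcal E_{\mathrm{har}}[Ju]:=\mathcal E[E_{\mathrm{har}}u]$ for $u\in\operatorname{dom}J$ (well defined). The form $\mathcal E^J$ in $\mathcal H$ is defined by $\operatorname{dom}\mathcal E^J:=\operatorname{dom}J$, $\mathcal E^J[u]:=\mathcal E[u]+\|Ju\|_{\mathrm{aux}}^2$. When $\mathcal E^J$ defines a scalar product on $\operatorname{dom}J$, $\mathcal H^J$ denotes the completion of $\operatorname{dom}J$ with respect to $\mathcal E^J$ and $P^J$ the $\mathcal E^J$-orthogonal projection in $\mathcal H^J$ onto the $\mathcal E^J$-orthogonal complement of $\ker J$ (for $\ker J$ closed in $\mathcal H^J$ one has $P^Ju\in\operatorname{dom}J$ for $u\in\operatorname{dom}J$). *)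

theory Defs
  imports "HOL-Analysis.Analysis"
begin

section \<open>Scalars and Hilbert spaces\<close>

text \<open>A common treatment of real and complex scalars. A real normed field is isomorphic to the
  reals or to the complex numbers, and \<open>mult_sconj\<close> forces \<open>sconj\<close> to be the identity or complex
  conjugation, respectively.\<close>

class rc_field = real_normed_field + banach +
  fixes sconj :: "'a \<Rightarrow> 'a" and sre :: "'a \<Rightarrow> real"
  assumes sconj_add: "sconj (x + y) = sconj x + sconj y"
    and sconj_mult: "sconj (x * y) = sconj x * sconj y"
    and mult_sconj: "x * sconj x = (norm x)\<^sup>2 *\<^sub>R 1"
    and sre_sconj: "(2 * sre x) *\<^sub>R 1 = x + sconj x"

instantiation real :: rc_field
begin
definition sconj_real :: "real \<Rightarrow> real" where "sconj_real x = x"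
definition sre_real :: "real \<Rightarrow> real" where "sre_real x = x"
instance
  by standard (simp_all add: sconj_real_def sre_real_def power2_eq_square)
end

instantiation complex :: rc_field
begin
definition sconj_complex :: "complex \<Rightarrow> complex" where "sconj_complex = cnj"
definition sre_complex :: "complex \<Rightarrow> real" where "sre_complex = Re"
instance
  by standard (simp_all add: sconj_complex_def sre_complex_def scaleR_conv_of_real
      complex_norm_square complex_add_cnj del: of_real_power)
end

text \<open>The class \<open>banach\<close> supplies the norm, its topology and completeness; the scalar
  multiplication and the inner product over the chosen field are required to be compatible.\<close>

locale hilbert_space = vector_space smul
  for smul :: "'k::rc_field \<Rightarrow> 'h::banach \<Rightarrow> 'h" +
  fixes ip :: "'h \<Rightarrow> 'h \<Rightarrow> 'k"
  assumes smul_of_real: "smul (of_real r) x = r *\<^sub>R x"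
    and ip_add_left: "ip (x + y) z = ip x z + ip y z"
    and ip_smul_left: "ip (smul c x) y = c * ip x y"
    and ip_commute: "ip y x = sconj (ip x y)"
    and ip_self: "ip x x = of_real ((norm x)\<^sup>2)"

definition is_direct_sum ::
    "('k::field \<Rightarrow> 'h::ab_group_add \<Rightarrow> 'h) \<Rightarrow> 'h set \<Rightarrow> 'h set \<Rightarrow> 'h set \<Rightarrow> bool" where
  "is_direct_sum smul V A B \<longleftrightarrow>
     module.subspace smul A \<and> module.subspace smul B \<and>
     V = {a + b |a b. a \<in> A \<and> b \<in> B} \<and> A \<inter> B = {0}"


section \<open>Forms\<close>

text \<open>A form is a total function together with a domain \<open>S\<close>; its values off \<open>S\<close> are irrelevant.
  Hermitian symmetry makes it conjugate linear in the second argument.\<close>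

definition positive_form ::
    "('k::rc_field \<Rightarrow> 'h::ab_group_add \<Rightarrow> 'h) \<Rightarrow> 'h set \<Rightarrow> ('h \<Rightarrow> 'h \<Rightarrow> 'k) \<Rightarrow> bool" where
  "positive_form smul S q \<longleftrightarrow>
     module.subspace smul S \<and>
     (\<forall>u\<in>S. \<forall>v\<in>S. \<forall>w\<in>S. q (u + v) w = q u w + q v w) \<and>
     (\<forall>c. \<forall>u\<in>S. \<forall>v\<in>S. q (smul c u) v = c * q u v) \<and>
     (\<forall>u\<in>S. \<forall>v\<in>S. q v u = sconj (q u v)) \<and>
     (\<forall>u\<in>S. 0 \<le> sre (q u u))"

definition quad :: "('h \<Rightarrow> 'h \<Rightarrow> 'k::rc_field) \<Rightarrow> 'h \<Rightarrow> real" where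
  "quad q u = sre (q u u)"

definition scalar_product_on ::
    "('k::rc_field \<Rightarrow> 'h::ab_group_add \<Rightarrow> 'h) \<Rightarrow> 'h set \<Rightarrow> ('h \<Rightarrow> 'h \<Rightarrow> 'k) \<Rightarrow> bool" where
  "scalar_product_on smul S q \<longleftrightarrow>
     positive_form smul S q \<and> (\<forall>u\<in>S. quad q u = 0 \<longrightarrow> u = 0)"

text \<open>The locale \<open>Metric_space\<close> asks for symmetry and nonnegativity of the distance on the whole
  type, hence the value 0 off \<open>S\<close>.\<close>

definition form_dist ::
    "'h::ab_group_add set \<Rightarrow> ('h \<Rightarrow> 'h \<Rightarrow> 'k::rc_field) \<Rightarrow> 'h \<Rightarrow> 'h \<Rightarrow> real" where
  "form_dist S q u v = (if u \<in> S \<and> v \<in> S then sqrt (quad q (u - v)) else 0)"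

definition form_add :: "('h \<Rightarrow> 'h \<Rightarrow> 'k::plus) \<Rightarrow> ('h \<Rightarrow> 'h \<Rightarrow> 'k) \<Rightarrow> 'h \<Rightarrow> 'h \<Rightarrow> 'k" where
  "form_add q q' u v = q u v + q' u v"

definition closed_positive_form ::
    "('k::rc_field \<Rightarrow> 'h::banach \<Rightarrow> 'h) \<Rightarrow> ('h \<Rightarrow> 'h \<Rightarrow> 'k) \<Rightarrow> 'h set \<Rightarrow> ('h \<Rightarrow> 'h \<Rightarrow> 'k) \<Rightarrow> bool" where
  "closed_positive_form smul ip D E \<longleftrightarrow>
     positive_form smul D E \<and> Metric_space.mcomplete D (form_dist D (form_add E ip))"


section \<open>The operator \<open>J\<close>\<close>

definition linear_operator_on ::
    "('k::field \<Rightarrow> 'h::ab_group_add \<Rightarrow> 'h) \<Rightarrow> ('k \<Rightarrow> 'a::ab_group_add \<Rightarrow> 'a) \<Rightarrow>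
     'h set \<Rightarrow> ('h \<Rightarrow> 'a) \<Rightarrow> bool" where
  "linear_operator_on smul smul' S T \<longleftrightarrow>
     module.subspace smul S \<and>
     (\<forall>u\<in>S. \<forall>v\<in>S. T (u + v) = T u + T v) \<and>
     (\<forall>c. \<forall>u\<in>S. T (smul c u) = smul' c (T u))"

text \<open>Closedness as an operator from \<open>D\<close>, normed by \<open>\<E>\<^sub>1\<^sup>1\<^sup>/\<^sup>2\<close>, to the auxiliary space: the graph
  is closed in the product.\<close>

definition form_closed_operator ::
    "('h \<Rightarrow> 'h \<Rightarrow> 'k::rc_field) \<Rightarrow> 'h::banach set \<Rightarrow> ('h \<Rightarrow> 'h \<Rightarrow> 'k) \<Rightarrow>
     'h set \<Rightarrow> ('h \<Rightarrow> 'a::banach) \<Rightarrow> bool" where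
  "form_closed_operator ip D E domJ J \<longleftrightarrow>
     closedin
       (prod_topology (Metric_space.mtopology D (form_dist D (form_add E ip))) euclidean)
       {(u, J u) |u. u \<in> domJ}"

definition ker_on :: "'h set \<Rightarrow> ('h \<Rightarrow> 'a::zero) \<Rightarrow> 'h set" where
  "ker_on domJ J = {u \<in> domJ. J u = 0}"

definition Hhar :: "('h \<Rightarrow> 'h \<Rightarrow> 'k::zero) \<Rightarrow> 'h set \<Rightarrow> ('h \<Rightarrow> 'a::zero) \<Rightarrow> 'h set" where
  "Hhar E domJ J = {u \<in> domJ. \<forall>v \<in> ker_on domJ J. E u v = 0}"

definition Ehar_proj ::
    "('h::ab_group_add \<Rightarrow> 'h \<Rightarrow> 'k::zero) \<Rightarrow> 'h set \<Rightarrow> ('h \<Rightarrow> 'a::zero) \<Rightarrow> 'h \<Rightarrow> 'h" where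
  "Ehar_proj E domJ J u = (THE h. h \<in> Hhar E domJ J \<and> u - h \<in> ker_on domJ J)"

text \<open>Only meaningful on the range of \<open>J\<close>, the domain of this form.\<close>

definition Ehar ::
    "('h::ab_group_add \<Rightarrow> 'h \<Rightarrow> 'k::rc_field) \<Rightarrow> 'h set \<Rightarrow> ('h \<Rightarrow> 'a::zero) \<Rightarrow> 'a \<Rightarrow> real" where
  "Ehar E domJ J w = (THE r. \<forall>u\<in>domJ. J u = w \<longrightarrow> r = quad E (Ehar_proj E domJ J u))"

text \<open>The sesquilinear form belonging to \<open>\<E>\<^sup>J[u] = \<E>[u] + \<parallel>J u\<parallel>\<^sup>2\<close>.\<close>

definition formJ ::
    "('a \<Rightarrow> 'a \<Rightarrow> 'k::plus) \<Rightarrow> ('h \<Rightarrow> 'h \<Rightarrow> 'k) \<Rightarrow> ('h \<Rightarrow> 'a) \<Rightarrow> 'h \<Rightarrow> 'h \<Rightarrow> 'k" where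
  "formJ ip_aux E J u v = E u v + ip_aux (J u) (J v)"


section \<open>Completion of a space with scalar product\<close>

text \<open>The completion of \<open>S\<close> with respect to \<open>q\<close> consists of the classes of \<open>q\<close>-Cauchy sequences
  modulo sequences tending to 0. The definitions below are meant for
  a scalar product \<open>q\<close> on \<open>S\<close>; otherwise the limits and unions need not be well defined.\<close>

definition cauchy_rel ::
    "'h::ab_group_add set \<Rightarrow> ('h \<Rightarrow> 'h \<Rightarrow> 'k::rc_field) \<Rightarrow> ((nat \<Rightarrow> 'h) \<times> (nat \<Rightarrow> 'h)) set" where
  "cauchy_rel S q =
     {(X, Y). Metric_space.MCauchy S (form_dist S q) X \<and>
              Metric_space.MCauchy S (form_dist S q) Y \<and>
              (\<lambda>n. form_dist S q (X n) (Y n)) \<longlonglongrightarrow> 0}"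

definition hcompletion ::
    "'h::ab_group_add set \<Rightarrow> ('h \<Rightarrow> 'h \<Rightarrow> 'k::rc_field) \<Rightarrow> (nat \<Rightarrow> 'h) set set" where
  "hcompletion S q = {X. Metric_space.MCauchy S (form_dist S q) X} // cauchy_rel S q"

definition hembed ::
    "'h::ab_group_add set \<Rightarrow> ('h \<Rightarrow> 'h \<Rightarrow> 'k::rc_field) \<Rightarrow> 'h \<Rightarrow> (nat \<Rightarrow> 'h) set" where
  "hembed S q u = cauchy_rel S q `` {\<lambda>_. u}"

definition hminus ::
    "'h::ab_group_add set \<Rightarrow> ('h \<Rightarrow> 'h \<Rightarrow> 'k::rc_field) \<Rightarrow>
     (nat \<Rightarrow> 'h) set \<Rightarrow> (nat \<Rightarrow> 'h) set \<Rightarrow> (nat \<Rightarrow> 'h) set" where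
  "hminus S q A B = (\<Union>X\<in>A. \<Union>Y\<in>B. cauchy_rel S q `` {\<lambda>n. X n - Y n})"

definition hinner ::
    "('h \<Rightarrow> 'h \<Rightarrow> 'k::rc_field) \<Rightarrow> (nat \<Rightarrow> 'h) set \<Rightarrow> (nat \<Rightarrow> 'h) set \<Rightarrow> 'k" where
  "hinner q A B = (THE l. \<forall>X\<in>A. \<forall>Y\<in>B. (\<lambda>n. q (X n) (Y n)) \<longlonglongrightarrow> l)"

definition hdist ::
    "'h::ab_group_add set \<Rightarrow> ('h \<Rightarrow> 'h \<Rightarrow> 'k::rc_field) \<Rightarrow>
     (nat \<Rightarrow> 'h) set \<Rightarrow> (nat \<Rightarrow> 'h) set \<Rightarrow> real" where
  "hdist S q A B =
     (if A \<in> hcompletion S q \<and> B \<in> hcompletion S q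
      then sqrt (quad (hinner q) (hminus S q A B)) else 0)"

definition htopology ::
    "'h::ab_group_add set \<Rightarrow> ('h \<Rightarrow> 'h \<Rightarrow> 'k::rc_field) \<Rightarrow> (nat \<Rightarrow> 'h) set topology" where
  "htopology S q = Metric_space.mtopology (hcompletion S q) (hdist S q)"

definition hcomplement ::
    "'h::ab_group_add set \<Rightarrow> ('h \<Rightarrow> 'h \<Rightarrow> 'k::rc_field) \<Rightarrow>
     (nat \<Rightarrow> 'h) set set \<Rightarrow> (nat \<Rightarrow> 'h) set set" where
  "hcomplement S q M = {A \<in> hcompletion S q. \<forall>B\<in>M. hinner q A B = 0}"

text \<open>Orthogonal projection onto a closed subspace \<open>M\<close> of the completion.\<close>

definition hproj ::
    "'h::ab_group_add set \<Rightarrow> ('h \<Rightarrow> 'h \<Rightarrow> 'k::rc_field) \<Rightarrow> (nat \<Rightarrow> 'h) set set \<Rightarrow>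
     (nat \<Rightarrow> 'h) set \<Rightarrow> (nat \<Rightarrow> 'h) set" where
  "hproj S q M A = (THE P. P \<in> M \<and> hminus S q A P \<in> hcomplement S q M)"

definition PJ ::
    "('a \<Rightarrow> 'a \<Rightarrow> 'k::rc_field) \<Rightarrow> ('h::ab_group_add \<Rightarrow> 'h \<Rightarrow> 'k) \<Rightarrow> 'h set \<Rightarrow> ('h \<Rightarrow> 'a::zero) \<Rightarrow>
     (nat \<Rightarrow> 'h) set \<Rightarrow> (nat \<Rightarrow> 'h) set" where
  "PJ ip_aux E domJ J =
     hproj domJ (formJ ip_aux E J)
       (hcomplement domJ (formJ ip_aux E J)
         (hembed domJ (formJ ip_aux E J) ` ker_on domJ J))"

end

theory Submission
  imports Defs
begin

text \<open>
  Write \<open>q\<close> for the scalar product \<open>\<E>\<^sup>J\<close> on \<open>S = dom J\<close> and \<open>K = ker J\<close>. For \<open>v \<in> K\<close> the term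
  \<open>\<langle>J u, J v\<rangle>\<close> vanishes, so \<open>\<E>(u, v) = q(u, v)\<close>: the space \<open>\<H>\<^sub>h\<^sub>a\<^sub>r\<close> is exactly the \<open>q\<close>-orthogonal
  complement of \<open>K\<close> inside \<open>S\<close>. The first claim is therefore the projection theorem for \<open>K\<close> in the
  possibly incomplete space \<open>(S, q)\<close>. It holds because \<open>K\<close> is closed in the completion of
  \<open>S\<close>: a sequence in \<open>K\<close> minimising the distance to \<open>u\<close> is \<open>q\<close>-Cauchy by the parallelogram law,
  hence defines a point of the completion, and closedness says that this point comes from some
  \<open>k \<in> K\<close>. This \<open>k\<close> is a best approximation, so \<open>u - k\<close> is \<open>q\<close>-orthogonal to \<open>K\<close>
  (\<open>exists_orthogonal_part\<close>). The sum is direct because an element of both summands is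
  \<open>q\<close>-orthogonal to itself.

  For the second claim, \<open>u = h + k\<close> with \<open>h \<in> \<H>\<^sub>h\<^sub>a\<^sub>r\<close> and \<open>k \<in> K\<close> is also the orthogonal decomposition of
  \<open>u\<close> in the completion with respect to \<open>K\<^sup>\<bottom>\<close> and its complement; by uniqueness \<open>P\<^sup>J u\<close> is (the image of)
  \<open>h = E\<^sub>h\<^sub>a\<^sub>r u\<close> (\<open>hproj_hcomplement_hembed\<close>), and both sides of the identity are \<open>\<E>[h]\<close>.

  Since the completion consists of classes of Cauchy sequences, both arguments rest on the
  fact that inner product, difference and distance of classes are computed on representatives
  (\<open>tendsto_hinner_class\<close>, \<open>hminus_class\<close>, \<open>tendsto_hdist_class\<close>).
\<close>

section \<open>Conjugation and real part\<close>

lemma sconj_0 [simp]: "sconj (0::'k::rc_field) = 0"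
  using sconj_add[of "0::'k" 0] by simp

lemma mult_sconj_of_real: "x * sconj x = of_real ((norm (x::'k::rc_field))\<^sup>2)"
  by (simp add: mult_sconj of_real_def)

lemma norm_sconj [simp]: "norm (sconj x) = norm (x::'k::rc_field)"
proof (cases "x = 0")
  case False
  have "norm x * norm (sconj x) = norm x * norm x"
    using arg_cong[OF mult_sconj[of x], of norm]
    by (simp add: norm_mult power2_eq_square)
  with False show ?thesis by simp
qed simp

lemma sconj_of_real [simp]: "sconj (of_real r) = (of_real r :: 'k::rc_field)"
proof (cases "r = 0")
  case False
  have "of_real r * sconj (of_real r :: 'k) = of_real r * of_real r"
    using mult_sconj_of_real[of "of_real r :: 'k"] by (simp add: power2_eq_square)
  with False show ?thesis by simp
qed simp

lemma of_real_sre: "of_real (2 * sre x) = x + sconj (x::'k::rc_field)"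
  using sre_sconj[of x] by (simp add: of_real_def)

lemma sre_of_real [simp]: "sre (of_real r :: 'k::rc_field) = r"
proof -
  have "of_real (2 * sre (of_real r :: 'k)) = (of_real (2 * r) :: 'k)"
    by (subst of_real_sre) simp
  then show ?thesis by (simp only: of_real_eq_iff)
qed

lemma sre_add: "sre (x + y) = sre x + sre (y::'k::rc_field)"
proof -
  have "of_real (2 * sre (x + y)) = (of_real (2 * sre x + 2 * sre y) :: 'k)"
    unfolding of_real_add of_real_sre by (simp add: sconj_add)
  then show ?thesis by (simp only: of_real_eq_iff)
qed

lemma sre_diff: "sre (x - y) = sre x - sre (y::'k::rc_field)"
  using sre_add[of "x - y" y] by simp

lemma abs_sre_le_norm: "\<bar>sre x\<bar> \<le> norm (x::'k::rc_field)"
proof -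
  have "\<bar>2 * sre x\<bar> = norm (x + sconj x)"
    using arg_cong[OF of_real_sre[of x], of norm] by (simp only: norm_of_real)
  also have "\<dots> \<le> 2 * norm x"
    using norm_triangle_ineq[of x "sconj x"] by simp
  finally show ?thesis by simp
qed

lemma sre_sconj_eq [simp]: "sre (sconj x) = sre (x::'k::rc_field)"
proof -
  have "x * sconj (sconj x) = x * x"
  proof (cases "x = 0")
    case False
    have "sconj x * sconj (sconj x) = sconj x * x"
      using mult_sconj_of_real[of "sconj x"] mult_sconj_of_real[of x] by (simp add: mult.commute)
    moreover have "sconj x \<noteq> 0" using False norm_sconj[of x] by fastforce
    ultimately show ?thesis by simp
  qed simp
  then have "sconj (sconj x) = x" by (cases "x = 0") auto
  then have "of_real (2 * sre (sconj x)) = (of_real (2 * sre x) :: 'k)"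
    unfolding of_real_sre by (simp add: add.commute)
  then show ?thesis by (simp only: of_real_eq_iff)
qed

lemma tendsto_sre:
  assumes "(f \<longlongrightarrow> l) F"
  shows "((\<lambda>x. sre (f x)) \<longlongrightarrow> sre (l::'k::rc_field)) F"
proof -
  have "((\<lambda>x. norm (f x - l)) \<longlongrightarrow> 0) F"
    using assms LIM_zero tendsto_norm_zero by blast
  moreover have "\<forall>\<^sub>F x in F. norm (sre (f x) - sre l) \<le> norm (f x - l)"
    by (simp add: abs_sre_le_norm flip: sre_diff)
  ultimately have "((\<lambda>x. sre (f x) - sre l) \<longlongrightarrow> 0) F"
    by (rule Lim_null_comparison[rotated])
  then show ?thesis by (rule LIM_zero_cancel)
qed

section \<open>Spaces with scalar product\<close>

locale scalar_product_space = vector_space smul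
  for smul :: "'k::rc_field \<Rightarrow> 'h::ab_group_add \<Rightarrow> 'h" +
  fixes S :: "'h set" and q :: "'h \<Rightarrow> 'h \<Rightarrow> 'k"
  assumes scalar_product: "scalar_product_on smul S q"
begin

definition nrm :: "'h \<Rightarrow> real" where
  "nrm u = sqrt (quad q u)"

abbreviation cauchy :: "(nat \<Rightarrow> 'h) \<Rightarrow> bool" where
  "cauchy X \<equiv> Metric_space.MCauchy S (form_dist S q) X"

abbreviation cls :: "(nat \<Rightarrow> 'h) \<Rightarrow> (nat \<Rightarrow> 'h) set" where
  "cls X \<equiv> cauchy_rel S q `` {X}"

lemma subspace_S: "subspace S"
  using scalar_product unfolding scalar_product_on_def positive_form_def by blast

lemmas S_closed [simp, intro] =
  subspace_0[OF subspace_S] subspace_add[OF subspace_S]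
  subspace_diff[OF subspace_S] subspace_scale[OF subspace_S]

lemma q_add_left: "\<lbrakk>u \<in> S; v \<in> S; w \<in> S\<rbrakk> \<Longrightarrow> q (u + v) w = q u w + q v w"
  and q_smul_left: "\<lbrakk>u \<in> S; v \<in> S\<rbrakk> \<Longrightarrow> q (smul c u) v = c * q u v"
  and q_commute: "\<lbrakk>u \<in> S; v \<in> S\<rbrakk> \<Longrightarrow> q v u = sconj (q u v)"
  and quad_nonneg: "u \<in> S \<Longrightarrow> 0 \<le> quad q u"
  and quad_eq_0D: "\<lbrakk>u \<in> S; quad q u = 0\<rbrakk> \<Longrightarrow> u = 0"
  using scalar_product unfolding scalar_product_on_def positive_form_def quad_def by blast+

lemma q_add_right: "\<lbrakk>u \<in> S; v \<in> S; w \<in> S\<rbrakk> \<Longrightarrow> q w (u + v) = q w u + q w v"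
  using q_commute[of "u + v" w] q_commute[of u w] q_commute[of v w]
  by (simp add: q_add_left sconj_add)

lemma q_smul_right: "\<lbrakk>u \<in> S; v \<in> S\<rbrakk> \<Longrightarrow> q u (smul c v) = sconj c * q u v"
  using q_commute[of "smul c v" u] q_commute[of v u]
  by (simp add: q_smul_left sconj_mult)

lemma q_diff_left: "\<lbrakk>u \<in> S; v \<in> S; w \<in> S\<rbrakk> \<Longrightarrow> q (u - v) w = q u w - q v w"
  using q_add_left[of "u - v" v w] by simp

lemma q_diff_right: "\<lbrakk>u \<in> S; v \<in> S; w \<in> S\<rbrakk> \<Longrightarrow> q w (u - v) = q w u - q w v"
  using q_add_right[of "u - v" v w] by simp

lemma q_zero [simp]: "u \<in> S \<Longrightarrow> q 0 u = 0" "u \<in> S \<Longrightarrow> q u 0 = 0"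
  using q_diff_left[of u u u] q_diff_right[of u u u] by simp_all

lemma q_self: "u \<in> S \<Longrightarrow> q u u = of_real (quad q u)"
  using of_real_sre[of "q u u"] q_commute[of u u]
  by (simp add: quad_def flip: mult_2)

lemma quad_add:
  assumes "u \<in> S" "v \<in> S"
  shows "quad q (u + v) = quad q u + 2 * sre (q u v) + quad q v"
  using assms q_commute[of u v] by (simp add: quad_def q_add_left q_add_right sre_add)

lemma quad_smul:
  assumes "u \<in> S"
  shows "quad q (smul c u) = (norm c)\<^sup>2 * quad q u"
proof -
  have "q (smul c u) (smul c u) = (c * sconj c) * of_real (quad q u)"
    using assms by (simp add: q_smul_left q_smul_right q_self[of u] mult_ac)
  also have "\<dots> = of_real ((norm c)\<^sup>2 * quad q u)"
    by (simp add: mult_sconj_of_real)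
  finally show ?thesis by (simp only: quad_def sre_of_real)
qed

lemma quad_diff_commute: "u \<in> S \<Longrightarrow> v \<in> S \<Longrightarrow> quad q (u - v) = quad q (v - u)"
  by (simp add: quad_def q_diff_left q_diff_right algebra_simps)

lemma parallelogram:
  assumes "u \<in> S" "v \<in> S"
  shows "quad q (u + v) + quad q (u - v) = 2 * quad q u + 2 * quad q v"
  using assms by (simp add: quad_def q_diff_left q_diff_right q_add_left q_add_right
      sre_add sre_diff)

text \<open>Subtracting the component of \<open>u\<close> along \<open>v\<close>: this identity gives the Cauchy--Schwarz
  inequality, and it also shows that a best approximation has an orthogonal remainder. For \<open>v = 0\<close>
  the coefficient is \<open>0\<close> and the identity is trivial.\<close>

lemma quad_diff_component:
  assumes "u \<in> S" "v \<in> S"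
  shows "quad q (u - smul (of_real (inverse (quad q v)) * q u v) v)
           = quad q u - (norm (q u v))\<^sup>2 / quad q v"
proof -
  define r where "r = inverse (quad q v)"
  define c where "c = of_real r * q u v"
  have c': "sconj c = of_real r * q v u"
    using assms q_commute[of u v] by (simp add: c_def sconj_mult)
  have ab: "q u v * q v u = of_real ((norm (q u v))\<^sup>2)"
    using mult_sconj_of_real[of "q u v"] q_commute[of u v] assms by simp
  have "r * r * quad q v = r"
    by (cases "quad q v = 0") (simp_all add: r_def)
  then have rr: "of_real r * of_real r * of_real (quad q v) = (of_real r :: 'k)"
    by (metis of_real_mult)
  have "q (u - smul c v) (u - smul c v)
          = q u u - sconj c * q u v - c * q v u + c * sconj c * q v v"
    using assms by (simp add: q_diff_left q_diff_right q_smul_left q_smul_right algebra_simps)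
  also have "c * sconj c * q v v = (of_real r * of_real r * of_real (quad q v)) * (q u v * q v u)"
    unfolding c' q_self[OF assms(2)] by (simp only: c_def mult_ac)
  also have "\<dots> = of_real r * (q u v * q v u)"
    by (simp only: rr)
  also have "q u u - sconj c * q u v - c * q v u + \<dots>
               = of_real (quad q u) - of_real r * (q u v * q v u)"
    unfolding c' q_self[OF assms(1)] by (simp add: c_def mult_ac)
  also have "\<dots> = of_real (quad q u - r * (norm (q u v))\<^sup>2)"
    by (simp add: ab)
  finally show ?thesis
    by (simp only: quad_def[of q "u - _"] sre_of_real c_def r_def)
      (simp add: divide_inverse mult.commute)
qed

lemma nrm_nonneg [simp]: "u \<in> S \<Longrightarrow> 0 \<le> nrm u"
  by (simp add: nrm_def quad_nonneg)

lemma nrm_square: "u \<in> S \<Longrightarrow> (nrm u)\<^sup>2 = quad q u"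
  by (simp add: nrm_def quad_nonneg)

lemma nrm_zero [simp]: "nrm 0 = 0"
  by (simp add: nrm_def q_self[of 0, symmetric] quad_def)
    (metis of_real_0 sre_of_real)

lemma nrm_eq_0_iff: "u \<in> S \<Longrightarrow> nrm u = 0 \<longleftrightarrow> u = 0"
  using quad_eq_0D nrm_square[of u] by auto

lemma Cauchy_Schwarz:
  assumes "u \<in> S" "v \<in> S"
  shows "norm (q u v) \<le> nrm u * nrm v"
proof (cases "v = 0")
  case False
  then have pos: "quad q v > 0"
    using quad_nonneg[of v] quad_eq_0D[of v] assms by fastforce
  have "0 \<le> quad q u - (norm (q u v))\<^sup>2 / quad q v"
    using quad_nonneg assms by (simp flip: quad_diff_component)
  then have "(norm (q u v))\<^sup>2 \<le> quad q u * quad q v"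
    using pos by (simp add: field_simps)
  also have "\<dots> = (nrm u * nrm v)\<^sup>2"
    using assms by (simp add: power_mult_distrib nrm_square)
  finally show ?thesis
    by (rule power2_le_imp_le) (use assms in simp)
qed (use assms in simp)

lemma nrm_triangle:
  assumes "u \<in> S" "v \<in> S"
  shows "nrm (u + v) \<le> nrm u + nrm v"
proof -
  have "sre (q u v) \<le> nrm u * nrm v"
    using Cauchy_Schwarz[OF assms] abs_sre_le_norm[of "q u v"] by linarith
  then have "(nrm (u + v))\<^sup>2 \<le> (nrm u + nrm v)\<^sup>2"
    using assms by (simp add: power2_sum nrm_square quad_add)
  then show ?thesis
    by (rule power2_le_imp_le) (use assms in simp)
qed

lemma nrm_diff_commute: "u \<in> S \<Longrightarrow> v \<in> S \<Longrightarrow> nrm (u - v) = nrm (v - u)"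
  by (simp add: nrm_def quad_diff_commute)

lemma nrm_diff_triangle:
  "\<lbrakk>u \<in> S; v \<in> S; w \<in> S\<rbrakk> \<Longrightarrow> nrm (u - w) \<le> nrm (u - v) + nrm (v - w)"
  using nrm_triangle[of "u - v" "v - w"] by simp

lemma form_dist_eq: "u \<in> S \<Longrightarrow> v \<in> S \<Longrightarrow> form_dist S q u v = nrm (u - v)"
  by (simp add: form_dist_def nrm_def)

sublocale fd: Metric_space S "form_dist S q"
proof
  fix u v w
  show "0 \<le> form_dist S q u v"
    by (simp add: form_dist_def quad_nonneg)
  show "form_dist S q u v = form_dist S q v u"
    by (simp add: form_dist_def quad_diff_commute)
  show "form_dist S q u v = 0 \<longleftrightarrow> u = v" if "u \<in> S" "v \<in> S"
    using that nrm_eq_0_iff[of "u - v"] by (simp add: form_dist_eq)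
  show "form_dist S q u w \<le> form_dist S q u v + form_dist S q v w"
    if "u \<in> S" "v \<in> S" "w \<in> S"
    using that by (simp add: form_dist_eq nrm_diff_triangle)
qed

section \<open>Cauchy sequences and their classes\<close>

lemma cauchy_iff:
  "cauchy X \<longleftrightarrow> (\<forall>n. X n \<in> S) \<and>
     (\<forall>e>0. \<exists>N. \<forall>m n. N \<le> m \<longrightarrow> N \<le> n \<longrightarrow> nrm (X m - X n) < e)"
  by (auto simp: fd.MCauchy_def form_dist_eq image_subset_iff)

lemma cauchy_in [simp]: "cauchy X \<Longrightarrow> X n \<in> S"
  by (simp add: cauchy_iff)

lemma cauchyE:
  assumes "cauchy X" "e > 0"
  obtains N where "\<And>m n. N \<le> m \<Longrightarrow> N \<le> n \<Longrightarrow> nrm (X m - X n) < e"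
  using assms unfolding cauchy_iff by blast

lemma cauchy_const [intro]: "u \<in> S \<Longrightarrow> cauchy (\<lambda>_. u)"
  by (subst cauchy_iff) simp

lemma cauchy_diff [simp, intro]:
  assumes X: "cauchy X" and Y: "cauchy Y"
  shows "cauchy (\<lambda>n. X n - Y n)"
  unfolding cauchy_iff
proof (intro conjI allI impI)
  fix e :: real assume "e > 0"
  then have e2: "e / 2 > 0" by simp
  obtain M where M: "\<And>m n. M \<le> m \<Longrightarrow> M \<le> n \<Longrightarrow> nrm (X m - X n) < e / 2"
    using cauchyE[OF X e2] by blast
  obtain N where N: "\<And>m n. N \<le> m \<Longrightarrow> N \<le> n \<Longrightarrow> nrm (Y m - Y n) < e / 2"
    using cauchyE[OF Y e2] by blast
  have "nrm (X m - Y m - (X n - Y n)) < e" if "max M N \<le> m" "max M N \<le> n" for m n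
  proof -
    have "nrm ((X m - X n) + (Y n - Y m)) \<le> nrm (X m - X n) + nrm (Y n - Y m)"
      using X Y by (intro nrm_triangle) auto
    with M[of m n] N[of n m] that show ?thesis
      by (simp add: algebra_simps)
  qed
  then show "\<exists>N. \<forall>m n. N \<le> m \<longrightarrow> N \<le> n \<longrightarrow> nrm (X m - Y m - (X n - Y n)) < e"
    by blast
qed (use X Y in auto)

lemma cauchy_bounded:
  assumes "cauchy X"
  obtains B where "B > 0" "\<And>n. nrm (X n) \<le> B"
proof -
  obtain N where N: "\<And>m n. N \<le> m \<Longrightarrow> N \<le> n \<Longrightarrow> nrm (X m - X n) < 1"
    using cauchyE[OF assms zero_less_one] by blast
  define B where "B = Max ((\<lambda>n. nrm (X n)) ` {..N}) + 1"
  have B: "nrm (X n) + 1 \<le> B" if "n \<le> N" for n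
    using that by (simp add: B_def)
  have "nrm (X n) \<le> B" for n
  proof (cases "n \<le> N")
    case False
    then have "nrm (X n) \<le> nrm (X n - X N) + nrm (X N)"
      using nrm_triangle[of "X n - X N" "X N"] assms by auto
    with N[of n N] B[of N] False show ?thesis by simp
  qed (use B[of n] in simp)
  moreover have "B > 0"
    using B[of 0] nrm_nonneg[of "X 0"] cauchy_in[OF assms, of 0] by linarith
  ultimately show ?thesis using that by blast
qed

lemma q_diff_bound:
  assumes "u \<in> S" "v \<in> S" "u' \<in> S" "v' \<in> S" "nrm u' \<le> A" "nrm v \<le> B"
  shows "norm (q u v - q u' v') \<le> nrm (u - u') * B + A * nrm (v - v')"
proof -
  have "q u v - q u' v' = q (u - u') v + q u' (v - v')"
    using assms by (simp add: q_diff_left q_diff_right)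
  then have "norm (q u v - q u' v') \<le> norm (q (u - u') v) + norm (q u' (v - v'))"
    by (simp add: norm_triangle_ineq)
  also have "\<dots> \<le> nrm (u - u') * nrm v + nrm u' * nrm (v - v')"
    using assms by (intro add_mono Cauchy_Schwarz) auto
  also have "\<dots> \<le> nrm (u - u') * B + A * nrm (v - v')"
    using assms by (intro add_mono mult_left_mono mult_right_mono) auto
  finally show ?thesis .
qed

text \<open>By the Cauchy--Schwarz inequality and the boundedness of Cauchy sequences, the values
  \<open>q (X n) (Y n)\<close> form a Cauchy sequence of scalars.\<close>

lemma convergent_q:
  assumes X: "cauchy X" and Y: "cauchy Y"
  shows "convergent (\<lambda>n. q (X n) (Y n))"
proof -
  obtain A where A: "A > 0" "\<And>n. nrm (X n) \<le> A" using cauchy_bounded[OF X] by blast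
  obtain B where B: "B > 0" "\<And>n. nrm (Y n) \<le> B" using cauchy_bounded[OF Y] by blast
  have "Cauchy (\<lambda>n. q (X n) (Y n))"
  proof (rule CauchyI)
    fix e :: real assume "e > 0"
    then have e2: "e / (2 * B) > 0" "e / (2 * A) > 0" using A B by simp_all
    obtain M where M: "\<And>m n. M \<le> m \<Longrightarrow> M \<le> n \<Longrightarrow> nrm (X m - X n) < e / (2 * B)"
      using cauchyE[OF X e2(1)] by blast
    obtain N where N: "\<And>m n. N \<le> m \<Longrightarrow> N \<le> n \<Longrightarrow> nrm (Y m - Y n) < e / (2 * A)"
      using cauchyE[OF Y e2(2)] by blast
    have "norm (q (X m) (Y m) - q (X n) (Y n)) < e" if "max M N \<le> m" "max M N \<le> n" for m n
    proof -
      have "norm (q (X m) (Y m) - q (X n) (Y n))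
              \<le> nrm (X m - X n) * B + A * nrm (Y m - Y n)"
        using X Y A B by (intro q_diff_bound) auto
      also have "\<dots> < e / (2 * B) * B + A * (e / (2 * A))"
        using M[of m n] N[of m n] that A B
        by (intro add_strict_mono mult_strict_right_mono mult_strict_left_mono) auto
      finally show ?thesis using A B by simp
    qed
    then show "\<exists>M. \<forall>m\<ge>M. \<forall>n\<ge>M. norm (q (X m) (Y m) - q (X n) (Y n)) < e"
      by blast
  qed
  then show ?thesis by (rule Cauchy_convergent)
qed

lemma cauchy_rel_iff:
  "(X, Y) \<in> cauchy_rel S q \<longleftrightarrow>
     cauchy X \<and> cauchy Y \<and> (\<lambda>n. nrm (X n - Y n)) \<longlonglongrightarrow> 0"
proof -
  have "(\<lambda>n. form_dist S q (X n) (Y n)) = (\<lambda>n. nrm (X n - Y n))" if "cauchy X" "cauchy Y"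
    using that by (auto simp: form_dist_eq)
  then show ?thesis by (auto simp: cauchy_rel_def)
qed

lemma equiv_cauchy_rel: "equiv {X. cauchy X} (cauchy_rel S q)"
proof (rule equivI)
  show "cauchy_rel S q \<subseteq> {X. cauchy X} \<times> {X. cauchy X}"
    by (auto simp: cauchy_rel_iff)
  show "refl_on {X. cauchy X} (cauchy_rel S q)"
    by (simp add: refl_on_def cauchy_rel_iff)
  show "sym (cauchy_rel S q)"
  proof (rule symI)
    fix X Y assume "(X, Y) \<in> cauchy_rel S q"
    moreover from this have "(\<lambda>n. nrm (X n - Y n)) = (\<lambda>n. nrm (Y n - X n))"
      unfolding cauchy_rel_iff by (intro ext nrm_diff_commute) simp_all
    ultimately show "(Y, X) \<in> cauchy_rel S q"
      by (simp add: cauchy_rel_iff)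
  qed
  show "trans (cauchy_rel S q)"
  proof (rule transI)
    fix X Y Z assume XY: "(X, Y) \<in> cauchy_rel S q" and YZ: "(Y, Z) \<in> cauchy_rel S q"
    then have "(\<lambda>n. nrm (X n - Y n) + nrm (Y n - Z n)) \<longlonglongrightarrow> 0"
      unfolding cauchy_rel_iff by (intro tendsto_add_zero) auto
    moreover have "\<forall>\<^sub>F n in sequentially.
        norm (nrm (X n - Z n)) \<le> nrm (X n - Y n) + nrm (Y n - Z n)"
      using XY YZ by (auto simp: cauchy_rel_iff intro!: always_eventually nrm_diff_triangle)
    ultimately have "(\<lambda>n. nrm (X n - Z n)) \<longlonglongrightarrow> 0"
      by (rule Lim_null_comparison[rotated])
    with XY YZ show "(X, Z) \<in> cauchy_rel S q"
      by (simp add: cauchy_rel_iff)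
  qed
qed

lemma cls_eq_iff:
  assumes "cauchy X" "cauchy Y"
  shows "cls X = cls Y \<longleftrightarrow> (\<lambda>n. nrm (X n - Y n)) \<longlonglongrightarrow> 0"
  using eq_equiv_class_iff[OF equiv_cauchy_rel, of X Y] assms by (simp add: cauchy_rel_iff)

lemma mem_cls_self: "cauchy X \<Longrightarrow> X \<in> cls X"
  by (simp add: cauchy_rel_iff)

lemma cls_in_hcompletion [simp, intro]: "cauchy X \<Longrightarrow> cls X \<in> hcompletion S q"
  by (auto simp: hcompletion_def intro: quotientI)

lemma hcompletion_cases:
  assumes "A \<in> hcompletion S q"
  obtains X where "cauchy X" "A = cls X"
  using assms by (auto simp: hcompletion_def elim: quotientE)

lemma hembed_in_hcompletion [simp, intro]: "u \<in> S \<Longrightarrow> hembed S q u \<in> hcompletion S q"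
  unfolding hembed_def by (intro cls_in_hcompletion cauchy_const)

lemma inj_on_hembed: "inj_on (hembed S q) S"
proof (rule inj_onI)
  fix u v assume uv: "u \<in> S" "v \<in> S" "hembed S q u = hembed S q v"
  then have "nrm (u - v) = 0"
    using cls_eq_iff[OF cauchy_const cauchy_const, of u v]
    by (simp add: hembed_def LIMSEQ_const_iff)
  with uv show "u = v" by (simp add: nrm_eq_0_iff)
qed

lemma tendsto_q_equiv:
  assumes X: "(X, X') \<in> cauchy_rel S q" and Y: "(Y, Y') \<in> cauchy_rel S q"
    and l: "(\<lambda>n. q (X n) (Y n)) \<longlonglongrightarrow> l"
  shows "(\<lambda>n. q (X' n) (Y' n)) \<longlonglongrightarrow> l"
proof -
  have c: "cauchy X" "cauchy X'" "cauchy Y" "cauchy Y'"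
    and z: "(\<lambda>n. nrm (X n - X' n)) \<longlonglongrightarrow> 0" "(\<lambda>n. nrm (Y n - Y' n)) \<longlonglongrightarrow> 0"
    using X Y by (auto simp: cauchy_rel_iff)
  obtain A where A: "\<And>n. nrm (X' n) \<le> A" using cauchy_bounded[OF c(2)] by metis
  obtain B where B: "\<And>n. nrm (Y n) \<le> B" using cauchy_bounded[OF c(3)] by metis
  have "(\<lambda>n. nrm (X n - X' n) * B + A * nrm (Y n - Y' n)) \<longlonglongrightarrow> 0"
    using z by (intro tendsto_add_zero tendsto_mult_left_zero tendsto_mult_right_zero)
  moreover have "\<forall>\<^sub>F n in sequentially. norm (q (X n) (Y n) - q (X' n) (Y' n))
      \<le> nrm (X n - X' n) * B + A * nrm (Y n - Y' n)"
    using c A B by (intro always_eventually allI q_diff_bound) auto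
  ultimately have "(\<lambda>n. q (X n) (Y n) - q (X' n) (Y' n)) \<longlonglongrightarrow> 0"
    by (rule Lim_null_comparison[rotated])
  from tendsto_diff[OF l this] show ?thesis by simp
qed

text \<open>The limit exists and does not depend on the representatives, so the definite description in
  \<open>hinner\<close> denotes it.\<close>

lemma tendsto_hinner_class:
  assumes "cauchy X" "cauchy Y"
  shows "(\<lambda>n. q (X n) (Y n)) \<longlonglongrightarrow> hinner q (cls X) (cls Y)"
proof -
  obtain l where l: "(\<lambda>n. q (X n) (Y n)) \<longlonglongrightarrow> l"
    using convergent_q[OF assms] by (auto simp: convergent_def)
  have "hinner q (cls X) (cls Y) = l"
    unfolding hinner_def
  proof (rule the_equality)
    show "\<forall>X'\<in>cls X. \<forall>Y'\<in>cls Y. (\<lambda>n. q (X' n) (Y' n)) \<longlonglongrightarrow> l"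
      using tendsto_q_equiv[OF _ _ l] by auto
    fix l' assume "\<forall>X'\<in>cls X. \<forall>Y'\<in>cls Y. (\<lambda>n. q (X' n) (Y' n)) \<longlonglongrightarrow> l'"
    then have "(\<lambda>n. q (X n) (Y n)) \<longlonglongrightarrow> l'"
      using assms mem_cls_self by blast
    then show "l' = l" using l by (rule LIMSEQ_unique)
  qed
  with l show ?thesis by simp
qed

lemma hinner_hembed:
  assumes "u \<in> S" "v \<in> S"
  shows "hinner q (hembed S q u) (hembed S q v) = q u v"
  using tendsto_hinner_class[OF cauchy_const cauchy_const, of u v] assms
  by (simp add: hembed_def LIMSEQ_const_iff)

lemma hminus_class:
  assumes "cauchy X" "cauchy Y"
  shows "hminus S q (cls X) (cls Y) = cls (\<lambda>n. X n - Y n)"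
proof -
  have "cls (\<lambda>n. X' n - Y' n) = cls (\<lambda>n. X n - Y n)" if "X' \<in> cls X" "Y' \<in> cls Y" for X' Y'
  proof -
    have c: "cauchy X'" "cauchy Y'"
      and z: "(\<lambda>n. nrm (X n - X' n)) \<longlonglongrightarrow> 0" "(\<lambda>n. nrm (Y n - Y' n)) \<longlonglongrightarrow> 0"
      using that by (auto simp: cauchy_rel_iff)
    have "(\<lambda>n. nrm (X n - X' n) + nrm (Y n - Y' n)) \<longlonglongrightarrow> 0"
      using z by (rule tendsto_add_zero)
    moreover have "norm (nrm (X' n - Y' n - (X n - Y n)))
        \<le> nrm (X n - X' n) + nrm (Y n - Y' n)" for n
    proof -
      have "nrm ((X' n - X n) + (Y n - Y' n)) \<le> nrm (X' n - X n) + nrm (Y n - Y' n)"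
        using c assms by (intro nrm_triangle) auto
      then show ?thesis
        using c assms nrm_diff_commute[of "X' n" "X n"] by (simp add: algebra_simps)
    qed
    ultimately have "(\<lambda>n. nrm (X' n - Y' n - (X n - Y n))) \<longlonglongrightarrow> 0"
      by (rule Lim_null_comparison[OF always_eventually[OF allI], rotated])
    then show ?thesis using c assms by (simp add: cls_eq_iff cauchy_diff)
  qed
  moreover have "X \<in> cls X" "Y \<in> cls Y" using assms mem_cls_self by blast+
  ultimately show ?thesis unfolding hminus_def by blast
qed

lemma tendsto_hdist_class:
  assumes "cauchy X" "cauchy Y"
  shows "(\<lambda>n. nrm (X n - Y n)) \<longlonglongrightarrow> hdist S q (cls X) (cls Y)"
proof -
  have "hdist S q (cls X) (cls Y)
          = sqrt (sre (hinner q (cls (\<lambda>n. X n - Y n)) (cls (\<lambda>n. X n - Y n))))"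
    using assms by (simp add: hdist_def hminus_class quad_def cls_in_hcompletion)
  moreover have "(\<lambda>n. sqrt (sre (q (X n - Y n) (X n - Y n)))) \<longlonglongrightarrow> \<dots>"
    using assms by (intro tendsto_real_sqrt tendsto_sre tendsto_hinner_class cauchy_diff)
  ultimately show ?thesis by (simp add: nrm_def quad_def)
qed

text \<open>The topology of the completion is defined through \<open>Metric_space.mtopology\<close>; its
  characterisation by sequences is available only once the metric axioms are established.\<close>

sublocale hc: Metric_space "hcompletion S q" "hdist S q"
proof
  have nonneg: "0 \<le> hdist S q (cls X) (cls Y)" if "cauchy X" "cauchy Y" for X Y
    using tendsto_hdist_class[OF that] that by (intro LIMSEQ_le_const) auto
  have commute: "hdist S q (cls X) (cls Y) = hdist S q (cls Y) (cls X)"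
    if "cauchy X" "cauchy Y" for X Y
  proof -
    have "(\<lambda>n. nrm (X n - Y n)) = (\<lambda>n. nrm (Y n - X n))"
      using that by (intro ext nrm_diff_commute) simp_all
    then show ?thesis
      using tendsto_hdist_class[of X Y] tendsto_hdist_class[of Y X] that LIMSEQ_unique
      by metis
  qed
  fix A B C
  show "0 \<le> hdist S q A B"
  proof (cases "A \<in> hcompletion S q \<and> B \<in> hcompletion S q")
    case True
    then show ?thesis by (metis hcompletion_cases nonneg)
  next
    case False
    then show ?thesis unfolding hdist_def by (simp only: if_False order_refl)
  qed
  show "hdist S q A B = hdist S q B A"
  proof (cases "A \<in> hcompletion S q \<and> B \<in> hcompletion S q")
    case True
    then show ?thesis by (metis hcompletion_cases commute)
  next
    case False
    then have "\<not> (B \<in> hcompletion S q \<and> A \<in> hcompletion S q)" by blast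
    with False show ?thesis unfolding hdist_def by (simp only: if_False)
  qed
  show "hdist S q A B = 0 \<longleftrightarrow> A = B"
    if AB: "A \<in> hcompletion S q" "B \<in> hcompletion S q"
  proof -
    obtain X Y where XY: "cauchy X" "A = cls X" "cauchy Y" "B = cls Y"
      using AB by (metis hcompletion_cases)
    then show ?thesis
      using tendsto_hdist_class[of X Y] cls_eq_iff[of X Y] LIMSEQ_unique by metis
  qed
  show "hdist S q A C \<le> hdist S q A B + hdist S q B C"
    if ABC: "A \<in> hcompletion S q" "B \<in> hcompletion S q" "C \<in> hcompletion S q"
  proof -
    obtain X Y Z where X: "cauchy X" "A = cls X" and Y: "cauchy Y" "B = cls Y"
      and Z: "cauchy Z" "C = cls Z"
      using ABC by (metis hcompletion_cases)
    have "(\<lambda>n. nrm (X n - Y n) + nrm (Y n - Z n)) \<longlonglongrightarrow> hdist S q A B + hdist S q B C"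
      using X Y Z by (auto intro!: tendsto_add tendsto_hdist_class)
    moreover have "(\<lambda>n. nrm (X n - Z n)) \<longlonglongrightarrow> hdist S q A C"
      using X Z by (auto intro: tendsto_hdist_class)
    moreover have "nrm (X n - Z n) \<le> nrm (X n - Y n) + nrm (Y n - Z n)" for n
      using X Y Z by (intro nrm_diff_triangle) auto
    ultimately show ?thesis
      by (intro LIMSEQ_le) auto
  qed
qed

lemma hembed_tendsto_class:
  assumes X: "cauchy X"
  shows "(\<lambda>n. hdist S q (hembed S q (X n)) (cls X)) \<longlonglongrightarrow> 0"
proof (rule LIMSEQ_I)
  fix e :: real assume "e > 0"
  then have "e / 2 > 0" by simp
  then obtain N where N: "\<And>m n. N \<le> m \<Longrightarrow> N \<le> n \<Longrightarrow> nrm (X m - X n) < e / 2"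
    using cauchyE[OF X] by blast
  have "hdist S q (hembed S q (X n)) (cls X) \<le> e / 2" if "n \<ge> N" for n
  proof (rule LIMSEQ_le_const2)
    show "(\<lambda>m. nrm (X n - X m)) \<longlonglongrightarrow> hdist S q (hembed S q (X n)) (cls X)"
      unfolding hembed_def using X by (intro tendsto_hdist_class) auto
    show "\<exists>M. \<forall>m\<ge>M. nrm (X n - X m) \<le> e / 2"
      using N that by (meson less_imp_le)
  qed
  then show "\<exists>N. \<forall>n\<ge>N. norm (hdist S q (hembed S q (X n)) (cls X) - 0) < e"
    using \<open>e > 0\<close> by (intro exI[of _ N]) (fastforce simp: hc.nonneg)
qed

section \<open>Projection along a subspace closed in the completion\<close>

text \<open>The only use of the closedness in the completion: it supplies limits inside \<open>K\<close> for Cauchy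
  sequences in \<open>K\<close>, which \<open>S\<close>, being possibly incomplete, does not supply.\<close>

lemma closed_subset_limit:
  assumes K: "K \<subseteq> S" and closed: "closedin (htopology S q) (hembed S q ` K)"
    and X: "cauchy X" and XK: "\<And>n. X n \<in> K"
  obtains k where "k \<in> K" "(\<lambda>n. nrm (X n - k)) \<longlonglongrightarrow> 0"
proof -
  have "limitin hc.mtopology (\<lambda>n. hembed S q (X n)) (cls X) sequentially"
    unfolding hc.limitin_metric_dist_null using X by (auto intro: hembed_tendsto_class)
  then have "cls X \<in> hembed S q ` K"
    using closed XK
    by (intro limitin_closedin[of hc.mtopology _ "cls X" sequentially])
      (auto simp: htopology_def)
  then obtain k where "k \<in> K" "cls X = cls (\<lambda>_. k)"
    by (auto simp: hembed_def)
  with K X that show ?thesis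
    using cls_eq_iff[OF X cauchy_const, of k] by auto
qed

text \<open>The variational proof of the projection theorem: a minimising sequence for the distance of
  \<open>u\<close> from \<open>K\<close> is Cauchy, its limit in \<open>K\<close> attains the minimum, and subtracting the component of
  \<open>u - k\<close> along some \<open>v \<in> K\<close> cannot decrease the distance further.\<close>

lemma exists_orthogonal_part:
  assumes sub: "subspace K" and K: "K \<subseteq> S"
    and closed: "closedin (htopology S q) (hembed S q ` K)" and u: "u \<in> S"
  obtains k where "k \<in> K" "\<forall>v\<in>K. q (u - k) v = 0"
proof -
  define m where "m = (INF k\<in>K. quad q (u - k))"
  have K_ne: "K \<noteq> {}" using subspace_0[OF sub] by blast
  have bdd: "bdd_below ((\<lambda>k. quad q (u - k)) ` K)"
    using K u by (intro bdd_belowI[of _ 0]) (auto intro: quad_nonneg)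
  have m_le: "m \<le> quad q (u - k)" if "k \<in> K" for k
    unfolding m_def using bdd that by (rule cINF_lower)
  have "\<exists>k\<in>K. quad q (u - k) < m + 1 / real (Suc n)" for n
    using cINF_less_iff[OF K_ne bdd, of "m + 1 / real (Suc n)"] by (simp add: m_def)
  then obtain X where XK: "\<And>n. X n \<in> K" and X: "\<And>n. quad q (u - X n) < m + 1 / real (Suc n)"
    by metis
  have XS: "X n \<in> S" for n using XK K by blast
  \<comment> \<open>The midpoint of \<open>X i\<close> and \<open>X j\<close> lies in \<open>K\<close>, so it cannot be much closer to \<open>u\<close> than \<open>X i\<close> and
    \<open>X j\<close> are; the parallelogram law turns this into a bound for \<open>X i - X j\<close>.\<close>
  have close: "quad q (X i - X j) \<le> 2 / real (Suc i) + 2 / real (Suc j)" for i j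
  proof -
    define w where "w = smul (1 / 2) (X i + X j)"
    have wK: "w \<in> K" using XK sub by (simp add: w_def subspace_add subspace_scale)
    then have wS: "w \<in> S" using K by blast
    have "smul 2 w = X i + X j" by (simp add: w_def)
    moreover have "smul 2 u = u + u"
      using scale_left_distrib[of 1 1 u] by simp
    ultimately have mid: "(u - X i) + (u - X j) = smul 2 (u - w)"
      by (simp add: scale_right_diff_distrib algebra_simps)
    have "4 * m \<le> quad q (smul 2 (u - w))"
      using m_le[OF wK] u wS by (simp add: quad_smul)
    moreover have "quad q (smul 2 (u - w)) + quad q ((u - X i) - (u - X j))
        = 2 * quad q (u - X i) + 2 * quad q (u - X j)"
      unfolding mid[symmetric] using u XS by (intro parallelogram) auto
    moreover have "quad q ((u - X i) - (u - X j)) = quad q (X i - X j)"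
      using quad_diff_commute[of "X i" "X j"] XS by (simp add: algebra_simps)
    ultimately show ?thesis using X[of i] X[of j] by simp
  qed
  have cX: "cauchy X"
    unfolding cauchy_iff
  proof (intro conjI allI impI)
    fix e :: real assume e: "e > 0"
    then obtain N where N: "4 / e\<^sup>2 < real N" using reals_Archimedean2 by blast
    have "nrm (X i - X j) < e" if "N \<le> i" "N \<le> j" for i j
    proof -
      have "4 < real N * e\<^sup>2" using N e by (simp add: field_simps)
      also have "\<dots> \<le> real (Suc N) * e\<^sup>2"
        by (intro mult_right_mono) auto
      finally have 4: "4 / real (Suc N) < e\<^sup>2" by (simp add: field_simps)
      have "2 / real (Suc i) \<le> 2 / real (Suc N)" "2 / real (Suc j) \<le> 2 / real (Suc N)"
        using that by (intro divide_left_mono; simp)+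
      then have "quad q (X i - X j) \<le> 4 / real (Suc N)" using close[of i j] by simp
      with 4 have "(nrm (X i - X j))\<^sup>2 < e\<^sup>2" using XS by (simp add: nrm_square)
      then show ?thesis by (rule power2_less_imp_less) (use e in simp)
    qed
    then show "\<exists>N. \<forall>m n. N \<le> m \<longrightarrow> N \<le> n \<longrightarrow> nrm (X m - X n) < e" by blast
  qed (rule XS)
  obtain k where k: "k \<in> K" "(\<lambda>n. nrm (X n - k)) \<longlonglongrightarrow> 0"
    using closed_subset_limit[OF K closed cX XK] by blast
  have kS: "k \<in> S" using k K by blast
  have "nrm (u - k) \<le> sqrt m"
  proof (rule LIMSEQ_le_const)
    have "(\<lambda>n. 1 / real (Suc n)) \<longlonglongrightarrow> 0"
      using LIMSEQ_inverse_real_of_nat by (simp add: inverse_eq_divide)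
    then have "(\<lambda>n. sqrt (m + 1 / real (Suc n)) + nrm (X n - k)) \<longlonglongrightarrow> sqrt (m + 0) + 0"
      using k(2) by (intro tendsto_intros)
    then show "(\<lambda>n. sqrt (m + 1 / real (Suc n)) + nrm (X n - k)) \<longlonglongrightarrow> sqrt m" by simp
    have "nrm (u - X n) \<le> sqrt (m + 1 / real (Suc n))" for n
      unfolding nrm_def using X[of n] by (intro real_sqrt_le_mono) simp
    then have "nrm (u - k) \<le> sqrt (m + 1 / real (Suc n)) + nrm (X n - k)" for n
      using nrm_diff_triangle[OF u XS[of n] kS] by (meson add_right_mono order_trans)
    then show "\<exists>N. \<forall>n\<ge>N. nrm (u - k) \<le> sqrt (m + 1 / real (Suc n)) + nrm (X n - k)"
      by blast
  qed
  then have best: "quad q (u - k) \<le> m"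
    by (simp add: nrm_def)
  have "q (u - k) v = 0" if v: "v \<in> K" for v
  proof (cases "v = 0")
    case False
    have vS: "v \<in> S" using v K by blast
    then have pos: "quad q v > 0"
      using quad_nonneg[of v] quad_eq_0D[of v] False by fastforce
    define c where "c = of_real (inverse (quad q v)) * q (u - k) v"
    have "m \<le> quad q (u - (k + smul c v))"
      using k v sub by (intro m_le) (simp add: subspace_add subspace_scale)
    also have "u - (k + smul c v) = (u - k) - smul c v" by simp
    also have "quad q \<dots> = quad q (u - k) - (norm (q (u - k) v))\<^sup>2 / quad q v"
      unfolding c_def using u kS vS by (intro quad_diff_component) auto
    finally have "(norm (q (u - k) v))\<^sup>2 / quad q v \<le> 0" using best by simp
    with pos show ?thesis by (simp add: divide_le_0_iff)
  qed (use u kS in simp)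
  with k(1) that show ?thesis by blast
qed

text \<open>The orthogonal decomposition of an element of \<open>S\<close> inside \<open>S\<close> remains an orthogonal
  decomposition in the completion, where orthogonal projections are unique.\<close>

lemma hproj_hcomplement_hembed:
  assumes K: "K \<subseteq> S" and u: "u \<in> S" and k: "k \<in> K"
    and orth: "\<forall>v\<in>K. q (u - k) v = 0"
  shows "hproj S q (hcomplement S q (hembed S q ` K)) (hembed S q u) = hembed S q (u - k)"
    (is "hproj S q ?M _ = _")
  unfolding hproj_def
proof (rule the_equality)
  have kS: "k \<in> S" using K k by blast
  have k_orth: "(\<lambda>n. q k (Y n)) \<longlonglongrightarrow> 0" if Y: "cauchy Y" "cls Y \<in> ?M" for Y
  proof -
    have "hinner q (cls Y) (hembed S q k) = 0"
      using Y k by (simp add: hcomplement_def)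
    then have "(\<lambda>n. q (Y n) k) \<longlonglongrightarrow> 0"
      using tendsto_hinner_class[OF _ cauchy_const[OF kS], of Y] Y by (simp add: hembed_def)
    then have "(\<lambda>n. norm (q (Y n) k)) \<longlonglongrightarrow> 0" by (rule tendsto_norm_zero)
    moreover have "norm (q (Y n) k) = norm (q k (Y n))" for n
      using q_commute[of k "Y n"] Y kS by auto
    ultimately show ?thesis by (simp add: tendsto_norm_zero_iff)
  qed
  have h_in: "hembed S q (u - k) \<in> ?M"
    using u kS K orth by (auto simp: hcomplement_def hinner_hembed subset_iff)
  have "hinner q (hembed S q k) B = 0" if "B \<in> ?M" for B
  proof -
    have "B \<in> hcompletion S q" using that by (simp add: hcomplement_def)
    then obtain Y where Y: "cauchy Y" "B = cls Y" by (rule hcompletion_cases)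
    have "(\<lambda>n. q k (Y n)) \<longlonglongrightarrow> hinner q (hembed S q k) B"
      using tendsto_hinner_class[OF cauchy_const[OF kS], of Y] Y by (simp add: hembed_def)
    moreover have "(\<lambda>n. q k (Y n)) \<longlonglongrightarrow> 0" using k_orth Y that by blast
    ultimately show ?thesis by (rule LIMSEQ_unique)
  qed
  moreover have "hminus S q (hembed S q u) (hembed S q (u - k)) = hembed S q k"
    using hminus_class[OF cauchy_const cauchy_const, of u "u - k"] u kS
    by (simp add: hembed_def)
  ultimately show "hembed S q (u - k) \<in> ?M \<and>
      hminus S q (hembed S q u) (hembed S q (u - k)) \<in> hcomplement S q ?M"
    using h_in kS by (simp add: hcomplement_def[of S q ?M] hembed_in_hcompletion)
  fix P assume P: "P \<in> ?M \<and> hminus S q (hembed S q u) P \<in> hcomplement S q ?M"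
  then have "P \<in> hcompletion S q" by (simp add: hcomplement_def)
  then obtain Y where Y: "cauchy Y" "P = cls Y" by (rule hcompletion_cases)
  define Z where "Z = (\<lambda>n. (u - k) - Y n)"
  have Z: "cauchy Z" unfolding Z_def using u kS Y by (intro cauchy_diff) auto
  \<comment> \<open>The difference of the two candidates is both in \<open>K\<^sup>\<bottom>\<close> and orthogonal to \<open>K\<^sup>\<bottom>\<close>.\<close>
  have ZM: "cls Z \<in> ?M"
  proof -
    have "hinner q (cls Z) (hembed S q v) = 0" if v: "v \<in> K" for v
    proof -
      have vS: "v \<in> S" using v K by blast
      have "(\<lambda>n. q (Y n) v) \<longlonglongrightarrow> hinner q P (hembed S q v)"
        using tendsto_hinner_class[OF _ cauchy_const[OF vS], of Y] Y by (simp add: hembed_def)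
      moreover have "hinner q P (hembed S q v) = 0"
        using P v by (simp add: hcomplement_def)
      ultimately have "(\<lambda>n. q (u - k) v - q (Y n) v) \<longlonglongrightarrow> 0 - 0"
        using orth v by (intro tendsto_diff) auto
      moreover have "q (Z n) v = q (u - k) v - q (Y n) v" for n
        unfolding Z_def using u kS vS Y by (intro q_diff_left) auto
      ultimately have "(\<lambda>n. q (Z n) v) \<longlonglongrightarrow> 0" by simp
      moreover have "(\<lambda>n. q (Z n) v) \<longlonglongrightarrow> hinner q (cls Z) (hembed S q v)"
        using tendsto_hinner_class[OF Z cauchy_const[OF vS]] by (simp add: hembed_def)
      ultimately show ?thesis using LIMSEQ_unique by blast
    qed
    with Z show ?thesis by (auto simp: hcomplement_def)
  qed
  have W: "cauchy (\<lambda>n. u - Y n)" using u Y by (intro cauchy_diff) auto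
  have "cls (\<lambda>n. u - Y n) \<in> hcomplement S q ?M"
    using P hminus_class[OF cauchy_const[OF u] Y(1)] Y by (simp add: hembed_def)
  then have "hinner q (cls (\<lambda>n. u - Y n)) (cls Z) = 0"
    using ZM by (simp add: hcomplement_def[of S q ?M])
  then have "(\<lambda>n. q (u - Y n) (Z n)) \<longlonglongrightarrow> 0"
    using tendsto_hinner_class[OF W Z] by simp
  moreover have "(\<lambda>n. q k (Z n)) \<longlonglongrightarrow> 0" using k_orth[OF Z ZM] by blast
  ultimately have "(\<lambda>n. q (u - Y n) (Z n) - q k (Z n)) \<longlonglongrightarrow> 0 - 0"
    by (rule tendsto_diff)
  moreover have "q (u - Y n) (Z n) - q k (Z n) = q (Z n) (Z n)" for n
  proof -
    have "Z n = (u - Y n) - k" by (simp add: Z_def)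
    then show ?thesis
      using q_diff_left[of "u - Y n" k "Z n"] u kS Y Z by (metis S_closed(3) cauchy_in)
  qed
  ultimately have "(\<lambda>n. q (Z n) (Z n)) \<longlonglongrightarrow> 0" by simp
  from tendsto_real_sqrt[OF tendsto_sre[OF this]]
  have "(\<lambda>n. nrm (Z n)) \<longlonglongrightarrow> 0"
    using sre_of_real[of 0, where ?'k = 'k] by (simp add: nrm_def quad_def)
  then have "cls (\<lambda>_. u - k) = cls Y"
    using u kS Y by (subst cls_eq_iff) (auto simp: Z_def)
  then show "P = hembed S q (u - k)" using Y by (simp add: hembed_def)
qed

end

section \<open>Harmonic decomposition and the projection \<open>P\<^sup>J\<close>\<close>

theorem proposition3p8:
  fixes smul :: "'k::rc_field \<Rightarrow> 'h::banach \<Rightarrow> 'h"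
    and ip :: "'h \<Rightarrow> 'h \<Rightarrow> 'k"
    and smul_aux :: "'k \<Rightarrow> 'a::banach \<Rightarrow> 'a"
    and ip_aux :: "'a \<Rightarrow> 'a \<Rightarrow> 'k"
    and D :: "'h set"
    and E :: "'h \<Rightarrow> 'h \<Rightarrow> 'k"
    and domJ :: "'h set"
    and J :: "'h \<Rightarrow> 'a"
  assumes "hilbert_space smul ip"
    and "hilbert_space smul_aux ip_aux"
    and "closed_positive_form smul ip D E"
    and "domJ \<subseteq> D"
    and "linear_operator_on smul smul_aux domJ J"
    and "closure (J ` domJ) = UNIV"
    and "form_closed_operator ip D E domJ J"
    and "scalar_product_on smul domJ (formJ ip_aux E J)"
    and "closedin (htopology domJ (formJ ip_aux E J))
           (hembed domJ (formJ ip_aux E J) ` ker_on domJ J)"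
  shows "is_direct_sum smul domJ (Hhar E domJ J) (ker_on domJ J) \<and>
    (\<forall>u\<in>domJ.
       PJ ip_aux E domJ J (hembed domJ (formJ ip_aux E J) u)
         \<in> hembed domJ (formJ ip_aux E J) ` domJ \<and>
       Ehar E domJ J (J u) =
         quad E (the_inv_into domJ (hembed domJ (formJ ip_aux E J))
           (PJ ip_aux E domJ J (hembed domJ (formJ ip_aux E J) u))))"
proof -
  define q where "q = formJ ip_aux E J"
  define K where "K = ker_on domJ J"
  interpret H: hilbert_space smul ip by fact
  interpret A: hilbert_space smul_aux ip_aux by fact
  interpret sp: scalar_product_space smul domJ q
    by unfold_locales (use assms(8) in \<open>simp add: q_def\<close>)
  have J_add: "J (u + v) = J u + J v" if "u \<in> domJ" "v \<in> domJ" for u v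
    using assms(5) that by (simp add: linear_operator_on_def)
  have J_smul: "J (smul c u) = smul_aux c (J u)" if "u \<in> domJ" for c u
    using assms(5) that by (simp add: linear_operator_on_def)
  have J_diff: "J (u - v) = J u - J v" if "u \<in> domJ" "v \<in> domJ" for u v
    using J_add[of "u - v" v] that by simp
  have K_sub: "K \<subseteq> domJ" by (auto simp: K_def ker_on_def)
  have K: "H.subspace K"
  proof (rule H.subspaceI)
    show "0 \<in> K" using J_diff[of 0 0] by (simp add: K_def ker_on_def)
  qed (auto simp: K_def ker_on_def J_add J_smul)
  have ip_0: "ip_aux x 0 = 0" for x
    using A.ip_commute[of x 0] A.ip_add_left[of 0 0 x] by simp
  have q_K: "q u v = E u v" if "v \<in> K" for u v
    using that by (simp add: q_def formJ_def K_def ker_on_def ip_0)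
  have Hhar_eq: "Hhar E domJ J = {u \<in> domJ. \<forall>v\<in>K. q u v = 0}"
    unfolding Hhar_def using q_K by (auto simp: K_def)
  have Hhar: "H.subspace (Hhar E domJ J)"
    unfolding Hhar_eq using K_sub
    by (intro H.subspaceI) (auto simp: sp.q_add_left sp.q_smul_left subset_iff)
  have triv: "x = 0" if "x \<in> Hhar E domJ J" "x \<in> K" for x
    using that sp.quad_eq_0D[of x] sp.q_self[of x] K_sub by (auto simp: Hhar_eq)
  have closed: "closedin (htopology domJ q) (hembed domJ q ` K)"
    using assms(9) by (simp add: q_def K_def)
  have decomp: "\<exists>k\<in>K. u - k \<in> Hhar E domJ J" if u: "u \<in> domJ" for u
  proof -
    obtain k where "k \<in> K" "\<forall>v\<in>K. q (u - k) v = 0"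
      using sp.exists_orthogonal_part[OF K K_sub closed u] by blast
    then show ?thesis using u K_sub by (auto simp: Hhar_eq)
  qed
  have direct: "is_direct_sum smul domJ (Hhar E domJ J) K"
    unfolding is_direct_sum_def
  proof (intro conjI)
    show "domJ = {a + b |a b. a \<in> Hhar E domJ J \<and> b \<in> K}"
    proof
      show "domJ \<subseteq> {a + b |a b. a \<in> Hhar E domJ J \<and> b \<in> K}"
        using decomp by clarsimp (metis diff_add_cancel)
      show "{a + b |a b. a \<in> Hhar E domJ J \<and> b \<in> K} \<subseteq> domJ"
        using K_sub by (auto simp: Hhar_eq)
    qed
    show "Hhar E domJ J \<inter> K = {0}"
      using triv H.subspace_0[OF Hhar] H.subspace_0[OF K] by blast
  qed (rule Hhar K)+
  have proj: "Ehar_proj E domJ J u = h" if h: "h \<in> Hhar E domJ J" "u - h \<in> K" for u h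
    unfolding Ehar_proj_def
  proof (rule the_equality)
    show "h \<in> Hhar E domJ J \<and> u - h \<in> ker_on domJ J" using h by (simp add: K_def)
    fix h' assume h': "h' \<in> Hhar E domJ J \<and> u - h' \<in> ker_on domJ J"
    then have "h' - h \<in> Hhar E domJ J" using h Hhar by (auto intro: H.subspace_diff)
    moreover have "(u - h) - (u - h') \<in> K"
      using H.subspace_diff[OF K] h h' unfolding K_def by blast
    then have "h' - h \<in> K" by simp
    ultimately show "h' = h" using triv by fastforce
  qed
  have main: "PJ ip_aux E domJ J (hembed domJ q u) \<in> hembed domJ q ` domJ \<and>
      Ehar E domJ J (J u)
        = quad E (the_inv_into domJ (hembed domJ q) (PJ ip_aux E domJ J (hembed domJ q u)))"
    if u: "u \<in> domJ" for u
  proof -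
    obtain k where k: "k \<in> K" and h: "u - k \<in> Hhar E domJ J" using decomp u by blast
    have hS: "u - k \<in> domJ" using h by (simp add: Hhar_eq)
    have PJ: "PJ ip_aux E domJ J (hembed domJ q u) = hembed domJ q (u - k)"
      unfolding PJ_def q_def[symmetric] K_def[symmetric]
      using sp.hproj_hcomplement_hembed[OF K_sub u k] h by (simp add: Hhar_eq)
    \<comment> \<open>All \<open>u'\<close> with \<open>J u' = J u\<close> have the same harmonic part, so the value at \<open>J u\<close> is well defined.\<close>
    have same: "Ehar_proj E domJ J u' = u - k" if u': "u' \<in> domJ" "J u' = J u" for u'
    proof (rule proj[OF h])
      have "u' - u \<in> K" using u u' by (simp add: K_def ker_on_def J_diff)
      then have "(u' - u) + k \<in> K" using k K by (intro H.subspace_add)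
      then show "u' - (u - k) \<in> K" by (simp add: algebra_simps)
    qed
    have "Ehar E domJ J (J u) = quad E (u - k)"
      unfolding Ehar_def using same u by (intro the_equality) auto
    then show ?thesis
      using hS by (simp add: PJ the_inv_into_f_f[OF sp.inj_on_hembed])
  qed
  show ?thesis
    using direct main unfolding q_def K_def by blast
qed

end
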